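(* Let $\omega\in\mathbb{R}$ and let $x_n=x_n(\omega)=\operatorname{tr}(T_n(\omega))$ be the traces of the transfer matrices of the golden mean Fibonacci tiling ($m=1$, $l=1$), so that they satisfy the golden mean recursion relation $$x_{n+1}=x_n x_{n-1}-x_{n-2},\qquad n\geq 2.$$ Suppose that there exists some $N\in\mathbb{N}$ such that $$|x_N|>2,\qquad |x_{N+1}|\geq |x_N|\qquad\text{and}\qquad |x_{N+2}|\geq |x_{N+1}|.$$ Then $|x_{n+1}|\geq |x_n|$ for all $n>N$. Consequently, $|x_n|>2$ for all $n\geq N$, meaning that $\omega$ is in the super band gap $\mathcal{S}_N$.
   Context: Generalised Fibonacci tilings with parameters $m,l\ge 1$ (positive integers) are words $\mathcal{F}_n$ in two letters $A,B$ generated by the substitution $A\to A^mB^l$, $B\to A$, starting from $\mathcal{F}_0=B$, $\mathcal{F}_1=A$. To each frequency $\omega$ are associated transfer matrices $T_n(\omega)\in\mathbb{R}^{2\times 2}$ with $\det T_n(\omega)=1$, where $T_0$ is the transfer matrix of the element $B$, $T_1$ that of the element $A$, and $T_{n+1}=T_{n-1}^{\,l}\,T_n^{\,m}$ for $n\geq 1$. One writes $x_n(\omega)=\operatorname{tr}(T_n(\omega))$. The super band gap is $\mathcal{S}_N:=\{\omega\in\mathbb{R}: |x_n(\omega)|>2 \text{ for all } n\geq N\}$. *)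

theory Defs
  imports "HOL-Analysis.Analysis"
begin

datatype element = A | B

definition fib_subst :: "nat \<Rightarrow> nat \<Rightarrow> element list \<Rightarrow> element list" where
  "fib_subst m l w =
     concat (map (\<lambda>e. case e of A \<Rightarrow> replicate m A @ replicate l B | B \<Rightarrow> [A]) w)"

definition fib_tiling :: "nat \<Rightarrow> nat \<Rightarrow> nat \<Rightarrow> element list" where
  "fib_tiling m l n = (fib_subst m l ^^ n) [B]"

(* The state vector is propagated from left to right through the word, so the matrix of
   the first letter acts first and is the rightmost factor of the product. *)
primrec word_transfer :: "(element \<Rightarrow> real^2^2) \<Rightarrow> element list \<Rightarrow> real^2^2" where
  "word_transfer M [] = mat 1"
| "word_transfer M (e # w) = word_transfer M w ** M e"

(* T e \<omega> is the transfer matrix of the single element e at frequency \<omega>. *)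
definition transfer_matrix ::
    "(element \<Rightarrow> real \<Rightarrow> real^2^2) \<Rightarrow> nat \<Rightarrow> nat \<Rightarrow> nat \<Rightarrow> real \<Rightarrow> real^2^2" where
  "transfer_matrix T m l n \<omega> = word_transfer (\<lambda>e. T e \<omega>) (fib_tiling m l n)"

definition transfer_trace ::
    "(element \<Rightarrow> real \<Rightarrow> real^2^2) \<Rightarrow> nat \<Rightarrow> nat \<Rightarrow> nat \<Rightarrow> real \<Rightarrow> real" where
  "transfer_trace T m l n \<omega> = trace (transfer_matrix T m l n \<omega>)"

definition super_band_gap ::
    "(element \<Rightarrow> real \<Rightarrow> real^2^2) \<Rightarrow> nat \<Rightarrow> nat \<Rightarrow> nat \<Rightarrow> real set" where
  "super_band_gap T m l N = {\<omega>. \<forall>n\<ge>N. \<bar>transfer_trace T m l n \<omega>\<bar> > 2}"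

definition mat_power :: "real^2^2 \<Rightarrow> nat \<Rightarrow> real^2^2" where
  "mat_power M k = (((**) M) ^^ k) (mat 1)"

lemma fib_tiling_0: "fib_tiling m l 0 = [B]"
  by (simp add: fib_tiling_def)

lemma fib_tiling_1: "fib_tiling m l (Suc 0) = [A]"
  by (simp add: fib_tiling_def fib_subst_def)

lemma fib_subst_funpow_append:
  "(fib_subst m l ^^ n) (v @ w) = (fib_subst m l ^^ n) v @ (fib_subst m l ^^ n) w"
  by (induction n) (simp_all add: fib_subst_def)

lemma fib_subst_funpow_replicate:
  "(fib_subst m l ^^ n) (replicate k e) = concat (replicate k ((fib_subst m l ^^ n) [e]))"
proof (induction k)
  case 0
  show ?case by (induction n) (simp_all add: fib_subst_def)
next
  case (Suc k)
  have "replicate (Suc k) e = [e] @ replicate k e" by simp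
  then show ?case using Suc by (simp only: fib_subst_funpow_append) simp
qed

lemma fib_tiling_Suc_Suc:
  "fib_tiling m l (Suc (Suc n)) =
     concat (replicate m (fib_tiling m l (Suc n))) @ concat (replicate l (fib_tiling m l n))"
proof -
  have 1: "fib_subst m l [B] = [A]" "fib_subst m l [A] = replicate m A @ replicate l B"
    by (simp_all add: fib_subst_def)
  have 2: "fib_tiling m l (Suc k) = (fib_subst m l ^^ k) [A]" for k
    unfolding fib_tiling_def funpow_Suc_right by (simp add: 1)
  have "fib_tiling m l (Suc (Suc n)) = (fib_subst m l ^^ n) (replicate m A @ replicate l B)"
    by (simp only: 2 funpow_Suc_right o_apply 1)
  also have "\<dots> = concat (replicate m ((fib_subst m l ^^ n) [A])) @
                  concat (replicate l ((fib_subst m l ^^ n) [B]))"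
    by (simp only: fib_subst_funpow_append fib_subst_funpow_replicate)
  finally show ?thesis by (simp add: 2) (simp add: fib_tiling_def)
qed

lemma word_transfer_append:
  "word_transfer M (v @ w) = word_transfer M w ** word_transfer M v"
  by (induction v) (simp_all add: matrix_mul_assoc)

lemma mat_power_Suc_right: "mat_power M (Suc k) = mat_power M k ** M"
proof (induction k)
  case (Suc k)
  have "mat_power M (Suc (Suc k)) = M ** mat_power M (Suc k)" by (simp add: mat_power_def)
  also have "\<dots> = (M ** mat_power M k) ** M" by (simp add: Suc matrix_mul_assoc)
  finally show ?case by (simp add: mat_power_def)
qed (simp add: mat_power_def)

lemma word_transfer_replicate:
  "word_transfer M (concat (replicate k w)) = mat_power (word_transfer M w) k"
proof (induction k)
  case (Suc k)
  then show ?case by (simp add: word_transfer_append mat_power_Suc_right)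
qed (simp add: mat_power_def)

(* The matrices of the tilings obey the recursion T_{n+1} = T_{n-1}^l T_n^m. *)
lemma transfer_matrix_rec:
  shows "transfer_matrix T m l 0 \<omega> = T B \<omega>"
    and "transfer_matrix T m l (Suc 0) \<omega> = T A \<omega>"
    and "transfer_matrix T m l (Suc (Suc n)) \<omega> =
           mat_power (transfer_matrix T m l n \<omega>) l **
           mat_power (transfer_matrix T m l (Suc n) \<omega>) m"
  by (simp_all add: transfer_matrix_def fib_tiling_0 fib_tiling_1 fib_tiling_Suc_Suc
        word_transfer_append word_transfer_replicate)

end

theory Submission
  imports Defs
begin

text \<open>
  The recursion is the Cayley--Hamilton theorem in disguise.  Here \<open>T\<^sub>n = T\<^sub>n\<^sub>-\<^sub>2 T\<^sub>n\<^sub>-\<^sub>1\<close> and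
  \<open>T\<^sub>n\<^sub>+\<^sub>1 = T\<^sub>n\<^sub>-\<^sub>1 T\<^sub>n = T\<^sub>n\<^sub>-\<^sub>1 T\<^sub>n\<^sub>-\<^sub>2 T\<^sub>n\<^sub>-\<^sub>1\<close>.  By cyclicity of the trace, \<open>x\<^sub>n\<^sub>+\<^sub>1\<close> is the trace of
  \<open>T\<^sub>n\<^sub>-\<^sub>2 T\<^sub>n\<^sub>-\<^sub>1\<^sup>2\<close>, and the square may be replaced by \<open>x\<^sub>n\<^sub>-\<^sub>1 T\<^sub>n\<^sub>-\<^sub>1 - I\<close> because the determinant
  is one.  This is \<open>trace_sandwich_2x2\<close>.

  Growth comes from the recursion alone.  If \<open>2 < \<bar>x\<^sub>n\<^sub>-\<^sub>2\<bar> \<le> \<bar>x\<^sub>n\<^sub>-\<^sub>1\<bar> \<le> \<bar>x\<^sub>n\<bar>\<close>, the product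
  \<open>x\<^sub>n x\<^sub>n\<^sub>-\<^sub>1\<close> has modulus at least \<open>2 \<bar>x\<^sub>n\<bar>\<close>, and subtracting \<open>x\<^sub>n\<^sub>-\<^sub>2\<close> costs at most \<open>\<bar>x\<^sub>n\<bar>\<close>; hence
  \<open>\<bar>x\<^sub>n\<^sub>+\<^sub>1\<bar> \<ge> \<bar>x\<^sub>n\<bar>\<close>.  The chain of inequalities therefore reproduces itself one index
  further on, and induction propagates it forever.
\<close>

lemma det_word_transfer:
  assumes "\<And>e. det (M e) = 1"
  shows "det (word_transfer M w) = 1"
  using assms by (induction w) (simp_all add: det_mul)

text \<open>
  Cayley--Hamilton for \<open>Q\<close>, multiplied by \<open>P\<close> and traced: \<open>Q P Q\<close> has the same trace as
  \<open>P Q\<^sup>2 = tr(Q) P Q - det(Q) P\<close>.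
\<close>
lemma trace_sandwich_2x2:
  fixes P Q :: "'a::comm_ring_1^2^2"
  shows "trace (Q ** (P ** Q)) = trace (P ** Q) * trace Q - det Q * trace P"
  by (simp add: trace_def det_2 matrix_matrix_mult_def sum_2 algebra_simps)

lemma golden_mean_transfer_matrix_Suc_Suc:
  "transfer_matrix T 1 1 (Suc (Suc n)) \<omega> =
     transfer_matrix T 1 1 n \<omega> ** transfer_matrix T 1 1 (Suc n) \<omega>"
  by (simp add: transfer_matrix_rec(3) mat_power_def)

lemma golden_mean_trace_recursion:
  assumes "\<And>e. det (T e \<omega>) = 1"
  shows "transfer_trace T 1 1 (n + 3) \<omega> =
           transfer_trace T 1 1 (n + 2) \<omega> * transfer_trace T 1 1 (n + 1) \<omega>
           - transfer_trace T 1 1 n \<omega>"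
proof -
  let ?M = "\<lambda>k. transfer_matrix T 1 1 k \<omega>"
  have M2: "?M (n + 2) = ?M n ** ?M (n + 1)"
    using golden_mean_transfer_matrix_Suc_Suc[of T n \<omega>] by (simp add: numeral_2_eq_2)
  have M3: "?M (n + 3) = ?M (n + 1) ** (?M n ** ?M (n + 1))"
    using golden_mean_transfer_matrix_Suc_Suc[of T "n + 1" \<omega>] M2
    by (simp add: numeral_2_eq_2 numeral_3_eq_3)
  have "det (?M (n + 1)) = 1"
    unfolding transfer_matrix_def using assms by (rule det_word_transfer)
  then show ?thesis
    unfolding transfer_trace_def M3 M2 by (simp add: trace_sandwich_2x2)
qed

text \<open>
  One step of the growth argument.  The factor \<open>b\<close> at least doubles \<open>c\<close>, and the
  subtracted term can cancel no more than one of the two copies.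
\<close>
lemma abs_mult_diff_ge:
  fixes a b c :: "'a::linordered_idom"
  assumes "2 \<le> \<bar>b\<bar>" and "\<bar>a\<bar> \<le> \<bar>c\<bar>"
  shows "\<bar>c\<bar> \<le> \<bar>c * b - a\<bar>"
proof -
  have "\<bar>c\<bar> * 2 \<le> \<bar>c * b\<bar>"
    unfolding abs_mult using assms(1) by (intro mult_left_mono) auto
  moreover have "\<bar>c * b\<bar> - \<bar>a\<bar> \<le> \<bar>c * b - a\<bar>"
    by (rule abs_triangle_ineq2)
  ultimately show ?thesis
    using assms(2) by linarith
qed

text \<open>
  The induction must carry three consecutive terms, since the recursion looks back that
  far.  The bound at the lowest index keeps the multiplier in the next step above two.
\<close>
lemma abs_growth_of_trace_recursion:
  fixes x :: "nat \<Rightarrow> 'a::linordered_idom"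
  assumes rec: "\<And>n. x (n + 3) = x (n + 2) * x (n + 1) - x n"
    and start: "2 < \<bar>x N\<bar>" "\<bar>x N\<bar> \<le> \<bar>x (N + 1)\<bar>" "\<bar>x (N + 1)\<bar> \<le> \<bar>x (N + 2)\<bar>"
    and "N \<le> n"
  shows "2 < \<bar>x n\<bar> \<and> \<bar>x n\<bar> \<le> \<bar>x (n + 1)\<bar> \<and> \<bar>x (n + 1)\<bar> \<le> \<bar>x (n + 2)\<bar>"
  using \<open>N \<le> n\<close>
proof (induction n rule: dec_induct)
  case base
  show ?case using start by blast
next
  case (step n)
  then have "\<bar>x (n + 2)\<bar> \<le> \<bar>x (n + 2) * x (n + 1) - x n\<bar>"
    by (intro abs_mult_diff_ge) linarith+
  then have "\<bar>x (n + 2)\<bar> \<le> \<bar>x (n + 3)\<bar>"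
    by (simp only: rec)
  moreover have "Suc n = n + 1" "Suc n + 1 = n + 2" "Suc n + 2 = n + 3"
    by simp_all
  ultimately show ?case
    using step.IH by (metis less_le_trans)
qed

theorem theorem3p1:
  fixes T :: "element \<Rightarrow> real \<Rightarrow> real^2^2"
    and \<omega> :: real
    and x :: "nat \<Rightarrow> real"
  assumes det_T: "\<And>e \<omega>'. det (T e \<omega>') = 1"
    and x_def: "\<And>n. x n = transfer_trace T 1 1 n \<omega>"
  shows "(\<forall>n\<ge>2. x (n + 1) = x n * x (n - 1) - x (n - 2)) \<and>
         (\<forall>N. \<bar>x N\<bar> > 2 \<and> \<bar>x (N + 1)\<bar> \<ge> \<bar>x N\<bar> \<and> \<bar>x (N + 2)\<bar> \<ge> \<bar>x (N + 1)\<bar> \<longrightarrow>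
            (\<forall>n>N. \<bar>x (n + 1)\<bar> \<ge> \<bar>x n\<bar>) \<and>
            (\<forall>n\<ge>N. \<bar>x n\<bar> > 2) \<and>
            \<omega> \<in> super_band_gap T 1 1 N)"
proof (intro conjI allI impI)
  have rec: "x (n + 3) = x (n + 2) * x (n + 1) - x n" for n
    unfolding x_def using det_T by (rule golden_mean_trace_recursion)
  {
    fix n :: nat
    assume "2 \<le> n"
    then obtain k where "n = k + 2"
      by (metis add.commute le_Suc_ex)
    then show "x (n + 1) = x n * x (n - 1) - x (n - 2)"
      using rec[of k] by (simp add: numeral_3_eq_3)
  next
    fix N
    assume "\<bar>x N\<bar> > 2 \<and> \<bar>x (N + 1)\<bar> \<ge> \<bar>x N\<bar> \<and> \<bar>x (N + 2)\<bar> \<ge> \<bar>x (N + 1)\<bar>"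
    then have growth: "2 < \<bar>x n\<bar> \<and> \<bar>x n\<bar> \<le> \<bar>x (n + 1)\<bar>" if "N \<le> n" for n
      using abs_growth_of_trace_recursion[of x N n] rec that by blast
    show "\<bar>x n\<bar> \<le> \<bar>x (n + 1)\<bar>" if "N < n" for n
      using growth that by simp
    show "2 < \<bar>x n\<bar>" if "N \<le> n" for n
      using growth that by simp
    then show "\<omega> \<in> super_band_gap T 1 1 N"
      by (simp add: super_band_gap_def x_def)
  }
qed

end
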